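(* Let $f:\operatorname{dom} f\subseteq\mathbb{R}^n\to\mathbb{R}$ be $\mathcal{C}^4$ on $B_n(x^0;\overline{\Delta})$, where $x^0\in\operatorname{dom} f$ is the point of interest and $\overline{\Delta}>0$. Denote by $L_{\nabla^3 f}$ the Lipschitz constant of $\nabla^3 f$ on $\overline{B}_n(x^0;\overline{\Delta})$. Let $v$ be a non-zero vector in $\mathbb{R}^n$, $S=\begin{bmatrix}s^1&s^2&\cdots&s^m\end{bmatrix}\in\mathbb{R}^{n\times m}$, and $\overline{T}=hv$ where $h\ne0$. Assume that $B_n(x^0+s^j;\Delta_{\overline{T}})\subset B_n(x^0;\overline{\Delta})$ for all $j\in\{1,\dots,m\}$. Then $$\left\|\operatorname{P}_S\big(\nabla_c^2 f(x^0;S,\overline{T})v\big)-\operatorname{P}_S\big(\nabla^2 f(x^0)v\big)\right\|=\left\|\nabla_c^2 f(x^0;S,\overline{T})v-\operatorname{P}_S\big(\nabla^2 f(x^0)v\big)\right\|\le 2\sqrt{m}\,L_{\nabla^3 f}\,\frac{\Delta_u}{\Delta_l}\,\left\|(\widehat{S}^\top)^\dagger\right\|\,\|v\|\,\Delta_u^2.$$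
   Context: $\|\cdot\|$ is the Euclidean norm on vectors and the induced (spectral) norm on matrices. $B_n(x;\Delta)$ and $\overline{B}_n(x;\Delta)$ are the open and closed balls in $\mathbb{R}^n$ centered at $x$ of radius $\Delta$. $A^\dagger$ is the Moore-Penrose pseudoinverse of a real matrix $A$ (vectors in $\mathbb{R}^n$ are $n\times1$ matrices). $\oplus$ is the Minkowski sum; a matrix is identified with the set of its columns. Generalized simplex gradient: for a matrix $T=\begin{bmatrix}t^1&\cdots&t^k\end{bmatrix}\in\mathbb{R}^{n\times k}$ and a point $x$ with $x\in\operatorname{dom} f$ and $x\oplus T\subset\operatorname{dom} f$, $\nabla_s f(x;T)=(T^\top)^\dagger\,\delta_s f(x;T)\in\mathbb{R}^n$, where $\delta_s f(x;T)=\big(f(x+t^1)-f(x),\dots,f(x+t^k)-f(x)\big)^\top\in\mathbb{R}^k$. Generalized simplex Hessian (with the same matrix $\overline{T}$ used for every column of $S$): for $S=\begin{bmatrix}s^1&\cdots&s^m\end{bmatrix}\in\mathbb{R}^{n\times m}$ and $\overline{T}\in\mathbb{R}^{n\times k}$ such that $x^0\oplus\overline{T}$, $x^0\oplus S$, $x^0+s^j\oplus\overline{T}$ are contained in $\operatorname{dom} f$ for all $j$, $\nabla_s^2 f(x^0;S,\overline{T})=(S^\top)^\dagger\,\delta_s^2 f(x^0;S,\overline{T})\in\mathbb{R}^{n\times n}$, where $\delta_s^2 f(x^0;S,\overline{T})\in\mathbb{R}^{m\times n}$ is the matrix whose $j$-th row is $\big(\nabla_s f(x^0+s^j;\overline{T})-\nabla_s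 f(x^0;\overline{T})\big)^\top$. (Here $k=1$ and $\overline{T}=hv$.) Generalized centered simplex Hessian: $\nabla_c^2 f(x^0;S,\overline{T})=\tfrac12\big(\nabla_s^2 f(x^0;S,\overline{T})+\nabla_s^2 f(x^0;-S,-\overline{T})\big)$; it is defined when $x^0\oplus S\oplus\overline{T}$, $x^0\oplus(-S)\oplus(-\overline{T})$, $x^0\oplus(\pm S)$ and $x^0\oplus(\pm\overline{T})$ are contained in $\operatorname{dom} f$. Projection of a vector: for $w\in\mathbb{R}^n$, $\operatorname{P}_S w=(S^\top)^\dagger S^\top w$. Radii and normalized matrix: $\Delta_S=\max_j\|s^j\|$; $\Delta_{\overline{T}}=\|hv\|$; $\widehat{S}=S/\Delta_S$; $\Delta_u=\max\{\Delta_S,\Delta_{\overline{T}}\}$; $\Delta_l=\min\{\Delta_S,\Delta_{\overline{T}}\}$. Standing assumptions: all points required by these definitions lie in $\operatorname{dom} f$; $S$ is non-empty with non-null rank. *)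

theory Defs
  imports "HOL-Analysis.Analysis"
begin

section \<open>Pseudoinverse, spectral norm, projection\<close>

definition is_pinv :: "real^'n^'m \<Rightarrow> real^'m^'n \<Rightarrow> bool" where
  "is_pinv A X \<longleftrightarrow>
     A ** X ** A = A \<and> X ** A ** X = X \<and>
     transpose (A ** X) = A ** X \<and> transpose (X ** A) = X ** A"

definition pinv :: "real^'n^'m \<Rightarrow> real^'m^'n" where
  "pinv A = (THE X. is_pinv A X)"

text \<open>The library norm on matrices is the Frobenius norm, hence the explicit operator norm.\<close>

definition spectral_norm :: "real^'n^'m \<Rightarrow> real" where
  "spectral_norm A = onorm (\<lambda>x. A *v x)"

definition proj_vec :: "real^'m^'n \<Rightarrow> real^'n \<Rightarrow> real^'n" where
  "proj_vec S w = (pinv (transpose S) ** transpose S) *v w"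

definition radius :: "real^'m^'n \<Rightarrow> real" where
  "radius S = (MAX j. norm (column j S))"

definition normalized :: "real^'m^'n \<Rightarrow> real^'m^'n" where
  "normalized S = (1 / radius S) *\<^sub>R S"


section \<open>Simplex gradient and simplex Hessians\<close>

text \<open>A function with domain \<open>D\<close> is a total function whose values outside \<open>D\<close> are irrelevant.
  The directions are the columns of the matrices.\<close>

definition simplex_diff :: "(real^'n \<Rightarrow> real) \<Rightarrow> real^'n \<Rightarrow> real^'k^'n \<Rightarrow> real^'k" where
  "simplex_diff f x T = (\<chi> i. f (x + column i T) - f x)"

definition simplex_gradient :: "(real^'n \<Rightarrow> real) \<Rightarrow> real^'n \<Rightarrow> real^'k^'n \<Rightarrow> real^'n" where
  "simplex_gradient f x T = pinv (transpose T) *v simplex_diff f x T"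

definition simplex_diff2 ::
    "(real^'n \<Rightarrow> real) \<Rightarrow> real^'n \<Rightarrow> real^'m^'n \<Rightarrow> real^'k^'n \<Rightarrow> real^'n^'m" where
  "simplex_diff2 f x S T =
     (\<chi> j. simplex_gradient f (x + column j S) T - simplex_gradient f x T)"

definition simplex_hessian ::
    "(real^'n \<Rightarrow> real) \<Rightarrow> real^'n \<Rightarrow> real^'m^'n \<Rightarrow> real^'k^'n \<Rightarrow> real^'n^'n" where
  "simplex_hessian f x S T = pinv (transpose S) ** simplex_diff2 f x S T"

definition centered_simplex_hessian ::
    "(real^'n \<Rightarrow> real) \<Rightarrow> real^'n \<Rightarrow> real^'m^'n \<Rightarrow> real^'k^'n \<Rightarrow> real^'n^'n" where
  "centered_simplex_hessian f x S T =
     (1/2) *\<^sub>R (simplex_hessian f x S T + simplex_hessian f x (- S) (- T))"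

definition centered_simplex_hessian_defined ::
    "(real^'n) set \<Rightarrow> real^'n \<Rightarrow> real^'m^'n \<Rightarrow> real^'k^'n \<Rightarrow> bool" where
  "centered_simplex_hessian_defined D x S T \<longleftrightarrow>
     x \<in> D \<and>
     (\<forall>j i. x + column j S + column i T \<in> D \<and> x - column j S - column i T \<in> D) \<and>
     (\<forall>j. x + column j S \<in> D \<and> x - column j S \<in> D) \<and>
     (\<forall>i. x + column i T \<in> D \<and> x - column i T \<in> D)"


section \<open>Derivatives\<close>

definition gradient :: "(real^'n \<Rightarrow> real) \<Rightarrow> real^'n \<Rightarrow> real^'n" where
  "gradient f x = (\<chi> i. frechet_derivative f (at x) (axis i 1))"

definition hessian :: "(real^'n \<Rightarrow> real) \<Rightarrow> real^'n \<Rightarrow> real^'n^'n" where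
  "hessian f x = matrix (frechet_derivative (gradient f) (at x))"

text \<open>Higher derivatives are iterated Frechet derivatives relative to \<open>X\<close>, with values in
  iterated spaces of bounded linear maps; the norm there is the operator norm of multilinear
  maps. The relative derivative is the ordinary one at interior points of \<open>X\<close>, and is also
  uniquely determined at the boundary points of a ball.\<close>

definition deriv_on ::
    "'a set \<Rightarrow> ('a::real_normed_vector \<Rightarrow> 'b::real_normed_vector) \<Rightarrow> 'a \<Rightarrow> 'a \<Rightarrow>\<^sub>L 'b" where
  "deriv_on X f x = Blinfun (frechet_derivative f (at x within X))"

lemma deriv_on_works:
  assumes "f differentiable_on X" "x \<in> X"
  shows "(f has_derivative blinfun_apply (deriv_on X f x)) (at x within X)"
proof -
  have "(f has_derivative frechet_derivative f (at x within X)) (at x within X)"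
    using assms by (simp add: differentiable_on_def frechet_derivative_works)
  then show ?thesis
    by (simp add: deriv_on_def bounded_linear_Blinfun_apply has_derivative_bounded_linear)
qed

definition deriv3_on ::
    "'a set \<Rightarrow> ('a::real_normed_vector \<Rightarrow> real) \<Rightarrow> 'a \<Rightarrow> 'a \<Rightarrow>\<^sub>L 'a \<Rightarrow>\<^sub>L 'a \<Rightarrow>\<^sub>L real" where
  "deriv3_on X f = deriv_on X (deriv_on X (deriv_on X f))"

definition differentiable3_on :: "'a set \<Rightarrow> ('a::real_normed_vector \<Rightarrow> real) \<Rightarrow> bool" where
  "differentiable3_on X f \<longleftrightarrow>
     f differentiable_on X \<and>
     deriv_on X f differentiable_on X \<and>
     deriv_on X (deriv_on X f) differentiable_on X"

definition C4_on :: "'a set \<Rightarrow> ('a::real_normed_vector \<Rightarrow> real) \<Rightarrow> bool" where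
  "C4_on X f \<longleftrightarrow>
     differentiable3_on X f \<and>
     deriv3_on X f differentiable_on X \<and>
     continuous_on X (deriv_on X (deriv3_on X f))"

end

theory Submission
  imports Defs
begin

text \<open>
  Put \<open>w = hv\<close>. Since the pseudoinverse of a non-zero row \<open>w\<^sup>T\<close> is \<open>w / \<parallel>w\<parallel>\<^sup>2\<close>,
  the error vector is \<open>(S\<^sup>T)\<^sup>\<dagger> e\<close>, where \<open>2 h e\<^sub>j\<close> is the sum of the mixed second
  differences of \<open>f\<close> at \<open>x\<^sup>0\<close> in the directions \<open>(s\<^sup>j, w)\<close> and \<open>(- s\<^sup>j, - w)\<close>, minus twice
  \<open>D\<^sup>2 f(x\<^sup>0)(w, s\<^sup>j)\<close>. Two applications of the mean value theorem turn the differences into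
  \<open>D\<^sup>2 f(x\<^sup>0 + p)(w, s\<^sup>j) + D\<^sup>2 f(x\<^sup>0 - p)(w, s\<^sup>j)\<close> with \<open>\<parallel>p\<parallel> \<le> 2 \<Delta>\<^sub>u\<close>, and the Lipschitz
  condition on the third derivative bounds this symmetric difference to second order in \<open>p\<close>.
\<close>

section \<open>Moore-Penrose pseudoinverse\<close>

text \<open>\<open>A ** X\<close> and \<open>A ** Y\<close> are symmetric idempotents with the range
  of \<open>A\<close>, hence the same orthogonal projection; likewise \<open>X ** A\<close> and
  \<open>Y ** A\<close> agree. The equation \<open>X ** A ** X = X\<close> then recovers
  \<open>X\<close> from these products.\<close>

lemma is_pinv_unique:
  fixes A :: "real^'n^'m"
  assumes X: "is_pinv A X" and Y: "is_pinv A Y"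
  shows "X = Y"
proof -
  have AX: "A ** X = A ** Y"
  proof -
    have "A ** X = transpose (transpose (A ** X))" by simp
    also have "transpose (A ** X) = transpose ((A ** Y) ** (A ** X))"
      using Y by (simp add: is_pinv_def matrix_mul_assoc)
    also have "\<dots> = (A ** X) ** (A ** Y)"
      using X Y by (simp add: is_pinv_def matrix_transpose_mul)
    also have "\<dots> = A ** Y"
      using X by (simp add: is_pinv_def matrix_mul_assoc)
    also have "transpose (A ** Y) = A ** Y" using Y by (simp add: is_pinv_def)
    finally show ?thesis .
  qed
  have XA: "X ** A = Y ** A"
  proof -
    have "X ** A = transpose (transpose (X ** A))" by simp
    also have "transpose (X ** A) = transpose ((X ** A) ** (Y ** A))"
      using Y by (metis is_pinv_def matrix_mul_assoc)
    also have "\<dots> = (Y ** A) ** (X ** A)"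
      using X Y by (simp add: is_pinv_def matrix_transpose_mul)
    also have "\<dots> = Y ** A"
      using X by (metis is_pinv_def matrix_mul_assoc)
    also have "transpose (Y ** A) = Y ** A" using Y by (simp add: is_pinv_def)
    finally show ?thesis .
  qed
  have "X = X ** A ** X" using X by (simp add: is_pinv_def)
  also have "\<dots> = Y ** (A ** X)" by (simp add: XA matrix_mul_assoc)
  also have "\<dots> = Y ** A ** Y" by (simp add: AX matrix_mul_assoc)
  also have "\<dots> = Y" using Y by (simp add: is_pinv_def)
  finally show ?thesis .
qed

lemma pinv_eqI: "is_pinv A X \<Longrightarrow> pinv A = X"
  unfolding pinv_def using is_pinv_unique by blast

text \<open>The matrix of a linear map choosing preimages on the range of \<open>A\<close> serves as
  \<open>G\<close>.\<close>

lemma ex_inner_inverse: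
  fixes A :: "real^'n^'m"
  shows "\<exists>G. A ** G ** A = A"
proof -
  obtain g where g: "linear g" "\<And>x. A *v g (A *v x) = A *v x"
    using linear_exists_right_inverse_on[OF matrix_vector_mul_linear[of A] subspace_UNIV] by auto
  have "A ** matrix g ** A = A"
    unfolding matrix_eq
    by (simp add: g matrix_works matrix_vector_mul_assoc[symmetric])
  then show ?thesis ..
qed

lemma matrix_diff_ldistrib: "A ** (B - C) = A ** B - A ** C" for A :: "'a::ring_1^'n^'m"
  by (simp add: vec_eq_iff matrix_matrix_mult_def right_diff_distrib sum_subtractf)

text \<open>The squared norm of \<open>A *v (Y *v x)\<close> is the inner product of
  \<open>Y *v x\<close> with \<open>(transpose A ** A ** Y) *v x\<close>, so
  \<open>transpose A\<close> can be cancelled on the left.\<close>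

lemma transpose_mul_self_eq_0:
  fixes A :: "real^'n^'m" and Y :: "real^'k^'n"
  assumes "transpose A ** A ** Y = 0"
  shows "A ** Y = 0"
proof -
  have "A *v (Y *v x) = 0" for x
  proof -
    have "(A *v (Y *v x)) \<bullet> (A *v (Y *v x)) = (Y *v x) \<bullet> ((transpose A ** A ** Y) *v x)"
      by (metis dot_lmul_matrix inner_commute matrix_vector_mul_assoc transpose_matrix_vector)
    then show ?thesis using assms by simp
  qed
  then show ?thesis
    by (simp add: matrix_eq matrix_vector_mul_assoc[symmetric])
qed

text \<open>A least-squares inverse: \<open>(A\<^sup>T A)\<^sup>- A\<^sup>T\<close> for any inner inverse of \<open>A\<^sup>T A\<close>.\<close>

lemma ex_least_squares_inverse:
  fixes A :: "real^'n^'m"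
  shows "\<exists>U. A ** U ** A = A \<and> transpose (A ** U) = A ** U"
proof -
  obtain G where G: "transpose A ** A ** G ** (transpose A ** A) = transpose A ** A"
    using ex_inner_inverse by blast
  have "transpose A ** A ** (G ** transpose A ** A - mat 1) = 0"
    using G by (simp add: matrix_diff_ldistrib matrix_mul_assoc)
  then have "A ** (G ** transpose A ** A - mat 1) = 0"
    by (rule transpose_mul_self_eq_0)
  then have 1: "A ** G ** transpose A ** A = A"
    by (simp add: matrix_diff_ldistrib matrix_mul_assoc)
  have 2: "transpose A ** A ** transpose G ** transpose A = transpose A"
    using arg_cong[OF 1, of transpose] by (simp add: matrix_transpose_mul matrix_mul_assoc)
  \<comment> \<open>\<open>G\<close> need not be symmetric: the leading \<open>A\<close> is expanded
    by fact \<open>1\<close>, and the transposed fact \<open>2\<close> then removes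
    \<open>transpose G\<close>.\<close>
  have "transpose (A ** (G ** transpose A)) = A ** transpose G ** transpose A"
    by (simp add: matrix_transpose_mul matrix_mul_assoc)
  also have "\<dots> = (A ** G ** transpose A ** A) ** transpose G ** transpose A"
    by (simp add: 1)
  also have "\<dots> = A ** G ** (transpose A ** A ** transpose G ** transpose A)"
    by (simp add: matrix_mul_assoc)
  also have "\<dots> = A ** (G ** transpose A)"
    unfolding 2 by (simp add: matrix_mul_assoc)
  finally show ?thesis
    using 1 by (intro exI[of _ "G ** transpose A"]) (simp add: matrix_mul_assoc)
qed

text \<open>Urquhart's formula: a minimum-norm inverse \<open>V\<close> and a least-squares inverse \<open>U\<close> combine
  to the pseudoinverse \<open>V A U\<close>.\<close>

lemma ex_is_pinv:
  fixes A :: "real^'n^'m"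
  shows "\<exists>X. is_pinv A X"
proof -
  obtain U where U: "A ** U ** A = A" "transpose (A ** U) = A ** U"
    using ex_least_squares_inverse by blast
  \<comment> \<open>A minimum-norm inverse of \<open>A\<close> is the transpose of a least-squares
    inverse of \<open>transpose A\<close>.\<close>
  obtain W where W: "transpose A ** W ** transpose A = transpose A"
    "transpose (transpose A ** W) = transpose A ** W"
    using ex_least_squares_inverse by blast
  define V where "V = transpose W"
  have V: "A ** V ** A = A" "transpose (V ** A) = V ** A"
    using arg_cong[OF W(1), of transpose] W(2)
    by (simp_all add: V_def matrix_transpose_mul matrix_mul_assoc)
  define X where "X = V ** A ** U"
  have AX: "A ** X = A ** U"
    using V by (simp add: X_def matrix_mul_assoc)
  have XA: "X ** A = V ** A"
    unfolding X_def using U(1) by (metis matrix_mul_assoc)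
  have "X ** A ** X = V ** (A ** V ** A) ** U"
    unfolding XA by (simp add: X_def matrix_mul_assoc)
  then have "X ** A ** X = X" using V by (simp add: X_def)
  then have "is_pinv A X"
    unfolding is_pinv_def using AX XA U V by simp
  then show ?thesis ..
qed

lemma is_pinv_pinv: "is_pinv A (pinv A)"
  using ex_is_pinv pinv_eqI by metis

lemma pinv_scaleR:
  fixes A :: "real^'n^'m"
  assumes "c \<noteq> 0"
  shows "pinv (c *\<^sub>R A) = (1 / c) *\<^sub>R pinv A"
  using is_pinv_pinv[of A] assms
  by (intro pinv_eqI)
    (simp add: is_pinv_def scalar_matrix_assoc[symmetric] matrix_scalar_ac transpose_scalar)

lemma pinv_uminus: "pinv (- A) = - pinv A" for A :: "real^'n^'m"
  using pinv_scaleR[of "-1" A] by simp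

lemma pinv_rowvector:
  fixes w :: "real^'n"
  assumes "w \<noteq> 0"
  shows "pinv (rowvector w :: real^'n^1) = (1 / (w \<bullet> w)) *\<^sub>R columnvector w"
proof -
  have 1: "rowvector w ** columnvector w = (w \<bullet> w) *\<^sub>R (mat 1 :: real^1^1)"
    by (simp add: vec_eq_iff matrix_matrix_mult_def rowvector_def columnvector_def inner_vec_def
        mat_def)
  have "transpose (columnvector w ** (rowvector w :: real^'n^1)) = columnvector w ** (rowvector w :: real^'n^1)"
    by (simp add: matrix_transpose_mul transpose_columnvector transpose_rowvector)
  with 1 assms show ?thesis
    by (intro pinv_eqI)
      (simp add: is_pinv_def scalar_matrix_assoc[symmetric] matrix_scalar_ac transpose_scalar
        matrix_mul_assoc[symmetric])
qed

section \<open>Spectral norm, projection onto the column space, and radius\<close>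

lemma norm_matrix_vector_le_spectral_norm: "norm (A *v e) \<le> spectral_norm A * norm e" for A :: "real^'n^'m"
  unfolding spectral_norm_def by (rule onorm) simp

lemma spectral_norm_nonneg: "0 \<le> spectral_norm A" for A :: "real^'n^'m"
  unfolding spectral_norm_def by (rule onorm_pos_le) simp

lemma spectral_norm_scaleR: "spectral_norm (c *\<^sub>R A) = \<bar>c\<bar> * spectral_norm A" for A :: "real^'n^'m"
  using onorm_scaleR[OF matrix_vector_mul_bounded_linear[of A], of c]
  by (simp add: spectral_norm_def scaleR_matrix_vector_assoc)

text \<open>The projection fixes the range of \<open>pinv (transpose S)\<close> because
  \<open>X ** A ** X = X\<close>; this gives the equality of norms in the theorem.\<close>

lemma proj_vec_pinv: "proj_vec S (pinv (transpose S) *v y) = pinv (transpose S) *v y"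
  using is_pinv_pinv[of "transpose S"]
  by (simp add: proj_vec_def is_pinv_def matrix_vector_mul_assoc)

lemma norm_column_le_radius: "norm (column j S) \<le> radius S"
  unfolding radius_def by (rule Max_ge) auto

lemma radius_pos:
  assumes "rank S \<noteq> 0"
  shows "0 < radius S"
proof -
  have "S \<noteq> 0" using assms by auto
  then obtain j where "column j S \<noteq> 0"
    by (auto simp: vec_eq_iff column_def)
  then show ?thesis using norm_column_le_radius[of j S]
    by (metis less_le_trans zero_less_norm_iff)
qed

text \<open>Lets the factor \<open>radius S\<close> of the componentwise error be absorbed into the
  pseudoinverse of the normalized matrix.\<close>

lemma spectral_norm_pinv_normalized:
  assumes "radius S \<noteq> 0"
  shows "spectral_norm (pinv (transpose (normalized S)))
    = \<bar>radius S\<bar> * spectral_norm (pinv (transpose S))"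
  using assms by (simp add: normalized_def transpose_scalar pinv_scaleR spectral_norm_scaleR)

text \<open>Source of the factor sqrt m: comparison with the constant vector
  \<open>c\<close>.\<close>

lemma norm_vec_le_sqrt_card:
  fixes e :: "real^'m"
  assumes "\<And>j. \<bar>e $ j\<bar> \<le> c"
  shows "norm e \<le> sqrt (real CARD('m)) * c"
proof -
  have "0 \<le> c" using assms by (meson abs_ge_zero order_trans)
  have "norm e \<le> norm (\<chi> j::'m. c)"
    by (rule norm_le_componentwise_cart) (use assms \<open>0 \<le> c\<close> in auto)
  also have "\<dots> = sqrt (real CARD('m)) * c"
    using \<open>0 \<le> c\<close> by (simp add: norm_vec_def L2_set_def real_sqrt_mult)
  finally show ?thesis .
qed


section \<open>Second differences\<close>

lemma DERIV_along_line:
  fixes g :: "'a::real_normed_vector \<Rightarrow> real"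
  assumes "(g has_derivative g') (at (a + t *\<^sub>R u))"
  shows "((\<lambda>t. g (a + t *\<^sub>R u)) has_real_derivative g' u) (at t)"
proof -
  have "((\<lambda>t. a + t *\<^sub>R u) has_derivative (\<lambda>s. s *\<^sub>R u)) (at t)"
    by (auto intro!: derivative_eq_intros)
  from has_derivative_compose[OF this assms]
  have "((\<lambda>t. g (a + t *\<^sub>R u)) has_derivative (\<lambda>s. g' (s *\<^sub>R u))) (at t)" .
  moreover have "(\<lambda>s. g' (s *\<^sub>R u)) = (*) (g' u)"
    using has_derivative_linear[OF assms] by (auto simp: linear_scale)
  ultimately show ?thesis by (simp add: has_field_derivative_def)
qed

lemma symmetric_second_difference_le:
  fixes q :: "'a::real_normed_vector \<Rightarrow> real"
  assumes q: "\<And>y. y \<in> ball x r \<Longrightarrow> (q has_derivative q' y) (at y)"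
    and lip: "\<And>y z u. y \<in> ball x r \<Longrightarrow> z \<in> ball x r \<Longrightarrow> q' y u - q' z u \<le> M * norm (y - z) * norm u"
    and p: "norm p < r"
  shows "q (x + p) + q (x - p) - 2 * q x \<le> M * (norm p)\<^sup>2"
proof -
  \<comment> \<open>The subtracted term has derivative \<open>2 * M * (norm p)\<^sup>2 * t\<close>,
    which is the Lipschitz bound for two points at distance \<open>2 * t * norm p\<close>, so
    \<open>K\<close> does not increase.\<close>
  define K where "K t = q (x + t *\<^sub>R p) + q (x - t *\<^sub>R p) - M * (norm p)\<^sup>2 * t\<^sup>2" for t
  have "K 1 \<le> K 0"
  proof (rule DERIV_nonpos_imp_nonincreasing[where f = K])
    fix t :: real assume t: "0 \<le> t" "t \<le> 1"
    have "t * norm p < r"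
      using p t by (meson mult_left_le_one_le norm_ge_zero order_le_less_trans)
    then have mem: "x + t *\<^sub>R p \<in> ball x r" "x + t *\<^sub>R (- p) \<in> ball x r"
      using t by (auto simp: dist_norm)
    have 1: "((\<lambda>t. q (x + t *\<^sub>R p)) has_real_derivative q' (x + t *\<^sub>R p) p) (at t)"
      by (rule DERIV_along_line[OF q[OF mem(1)]])
    have 2: "((\<lambda>t. q (x - t *\<^sub>R p)) has_real_derivative q' (x - t *\<^sub>R p) (- p)) (at t)"
      using DERIV_along_line[OF q[OF mem(2)]] by simp
    have neg: "q' (x - t *\<^sub>R p) (- p) = - q' (x - t *\<^sub>R p) p"
      using q[OF mem(2)] by (simp add: has_derivative_linear linear_neg)
    have "(K has_real_derivative
        q' (x + t *\<^sub>R p) p - q' (x - t *\<^sub>R p) p - 2 * M * (norm p)\<^sup>2 * t) (at t)"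
      unfolding K_def by (rule derivative_eq_intros 1 2 refl)+ (simp add: neg)
    moreover have "q' (x + t *\<^sub>R p) p - q' (x - t *\<^sub>R p) p \<le> 2 * M * (norm p)\<^sup>2 * t"
    proof -
      have 3: "(x + t *\<^sub>R p) - (x - t *\<^sub>R p) = (2 * t) *\<^sub>R p"
        by (simp flip: scaleR_2)
      have "q' (x + t *\<^sub>R p) p - q' (x - t *\<^sub>R p) p
          \<le> M * norm ((x + t *\<^sub>R p) - (x - t *\<^sub>R p)) * norm p"
        using lip[OF mem] by simp
      also have "\<dots> = 2 * M * (norm p)\<^sup>2 * t"
        unfolding 3 using t by (simp add: power2_eq_square)
      finally show ?thesis .
    qed
    ultimately show "\<exists>y. (K has_real_derivative y) (at t) \<and> y \<le> 0"
      by (intro exI[of _ "q' (x + t *\<^sub>R p) p - q' (x - t *\<^sub>R p) p - 2 * M * (norm p)\<^sup>2 * t"])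
        simp
  qed simp
  then show ?thesis by (simp add: K_def)
qed

text \<open>The one-sided estimate is applied to \<open>q\<close> and to \<open>- q\<close>.\<close>

lemma abs_symmetric_second_difference_le:
  fixes q :: "'a::real_normed_vector \<Rightarrow> real"
  assumes q: "\<And>y. y \<in> ball x r \<Longrightarrow> (q has_derivative q' y) (at y)"
    and lip: "\<And>y z u. y \<in> ball x r \<Longrightarrow> z \<in> ball x r \<Longrightarrow>
      \<bar>q' y u - q' z u\<bar> \<le> M * norm (y - z) * norm u"
    and p: "norm p < r"
  shows "\<bar>q (x + p) + q (x - p) - 2 * q x\<bar> \<le> M * (norm p)\<^sup>2"
proof -
  have "q (x + p) + q (x - p) - 2 * q x \<le> M * (norm p)\<^sup>2"
    by (rule symmetric_second_difference_le[OF q _ p]) (use lip in \<open>auto simp: abs_le_iff\<close>)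
  moreover have "- q (x + p) + - q (x - p) - 2 * (- q x) \<le> M * (norm p)\<^sup>2"
  proof (rule symmetric_second_difference_le[where q' = "\<lambda>y u. - q' y u", OF _ _ p])
    fix y z u assume "y \<in> ball x r" "z \<in> ball x r"
    then show "- q' y u - - q' z u \<le> M * norm (y - z) * norm u"
      using lip[of y z u] by linarith
  qed (rule has_derivative_minus[OF q])
  ultimately show ?thesis by linarith
qed

text \<open>Applying the mean value theorem first along \<open>s\<close> and then along \<open>w\<close> avoids the symmetry of
  the second derivative. The points \<open>x \<plusminus> (s + w)\<close> may lie on the boundary of the ball,
  where \<open>f\<close> is only known to be continuous relative to \<open>X\<close>.\<close>

lemma mixed_difference_mvt:
  fixes f :: "'a::real_normed_vector \<Rightarrow> real"
  assumes D1: "\<And>y. y \<in> ball x r \<Longrightarrow> (f has_derivative blinfun_apply (D1 y)) (at y)"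
    and D2: "\<And>y. y \<in> ball x r \<Longrightarrow> (D1 has_derivative blinfun_apply (D2 y)) (at y)"
    and cont: "continuous_on X f" and X: "ball x r \<subseteq> X"
    and mem: "x + (s + w) \<in> X" "x - (s + w) \<in> X"
    and le: "norm s + norm w \<le> r" and s: "s \<noteq> 0" and w: "w \<noteq> 0"
  obtains a b where "0 < a" "a < 1" "0 < b" "b < 1"
    "(f (x + (s + w)) - f (x + s) - f (x + w) + f x)
      + (f (x - (s + w)) - f (x - s) - f (x - w) + f x)
     = D2 (x + (a *\<^sub>R s + b *\<^sub>R w)) w s + D2 (x - (a *\<^sub>R s + b *\<^sub>R w)) w s"
proof -
  \<comment> \<open>Since \<open>s\<close> and \<open>w\<close> are non-zero, only the corner
    \<open>a = b = 1\<close> can reach norm \<open>r\<close>.\<close>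
  have lt: "norm (a *\<^sub>R s + b *\<^sub>R w) < r"
    if "0 \<le> a" "a \<le> 1" "0 \<le> b" "b \<le> 1" "a < 1 \<or> b < 1" for a b
  proof -
    have "norm (a *\<^sub>R s + b *\<^sub>R w) \<le> a * norm s + b * norm w"
      using norm_triangle_ineq[of "a *\<^sub>R s" "b *\<^sub>R w"] that by simp
    also have "\<dots> < norm s + norm w"
    proof (cases "a < 1")
      case True
      then have "a * norm s < 1 * norm s" using s by (intro mult_strict_right_mono) auto
      moreover have "b * norm w \<le> 1 * norm w" using that by (intro mult_right_mono) auto
      ultimately show ?thesis by simp
    next
      case False
      then have "b * norm w < 1 * norm w" using w that by (intro mult_strict_right_mono) auto
      moreover have "a * norm s \<le> 1 * norm s" using that by (intro mult_right_mono) auto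
      ultimately show ?thesis by simp
    qed
    finally show ?thesis using le by simp
  qed
  have inb: "x + (b *\<^sub>R w + a *\<^sub>R s) \<in> ball x r" "x - (b *\<^sub>R w + a *\<^sub>R s) \<in> ball x r"
    if "0 \<le> a" "a \<le> 1" "0 \<le> b" "b \<le> 1" "a < 1 \<or> b < 1" for a b
    using lt[OF that] norm_minus_cancel[of "a *\<^sub>R s + b *\<^sub>R w"]
    by (simp_all add: dist_norm add.commute del: norm_minus_cancel)
  \<comment> \<open>At the remaining corner, membership in \<open>X\<close> is the assumption
    \<open>mem\<close>.\<close>
  have inX: "x + (b *\<^sub>R w + a *\<^sub>R s) \<in> X" "x - (b *\<^sub>R w + a *\<^sub>R s) \<in> X"
    if ab: "0 \<le> a" "a \<le> 1" "0 \<le> b" "b \<le> 1" for a b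
  proof -
    consider "a < 1 \<or> b < 1" | "a = 1" "b = 1" using ab by linarith
    then have "x + (b *\<^sub>R w + a *\<^sub>R s) \<in> X \<and> x - (b *\<^sub>R w + a *\<^sub>R s) \<in> X"
    proof cases
      case 1
      then show ?thesis using inb[OF ab] X by blast
    next
      case 2
      then show ?thesis using mem by (simp add: add.commute)
    qed
    then show "x + (b *\<^sub>R w + a *\<^sub>R s) \<in> X" "x - (b *\<^sub>R w + a *\<^sub>R s) \<in> X" by auto
  qed
  \<comment> \<open>\<open>\<phi> b\<close> adds \<open>f\<close> along two lines traversed in
    opposite directions, so that both second differences form one increment and share the same
    \<open>a\<close> and \<open>b\<close>. \<open>\<phi>'\<close> is its derivative in
    \<open>t\<close>, and \<open>\<phi>''\<close> the derivative of \<open>\<phi>'\<close> in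
    \<open>b\<close>.\<close>
  define \<phi> where "\<phi> b t = f ((x + b *\<^sub>R w) + t *\<^sub>R s) + f ((x - b *\<^sub>R w) + t *\<^sub>R (- s))" for b t
  define \<phi>' where "\<phi>' b t = D1 ((x + b *\<^sub>R w) + t *\<^sub>R s) s + D1 ((x - b *\<^sub>R w) + t *\<^sub>R (- s)) (- s)" for b t
  define \<phi>'' where "\<phi>'' b t = D2 ((x + t *\<^sub>R s) + b *\<^sub>R w) w s + D2 ((x - t *\<^sub>R s) + b *\<^sub>R (- w)) (- w) (- s)" for b t
  have cont_\<phi>: "continuous_on {0..1} (\<phi> b)" if "0 \<le> b" "b \<le> 1" for b
    unfolding \<phi>_def
    by (intro continuous_intros continuous_on_compose2[OF cont])
      (use inX that in \<open>auto simp: algebra_simps\<close>)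
  have D\<phi>: "(\<phi> b has_real_derivative \<phi>' b t) (at t)" if "0 \<le> b" "b \<le> 1" "0 < t" "t < 1" for b t
    unfolding \<phi>_def \<phi>'_def
    by (intro derivative_intros DERIV_along_line D1)
      (use inb[of t b] that in \<open>simp_all add: algebra_simps\<close>)
  have D\<phi>': "((\<lambda>b. \<phi>' b t) has_real_derivative \<phi>'' b t) (at b)" if "0 \<le> b" "b \<le> 1" "0 < t" "t < 1" for b t
  proof -
    have D: "((\<lambda>y. D1 y u) has_derivative (\<lambda>z. D2 y z u)) (at y)" if "y \<in> ball x r" for y u
      using bounded_linear.has_derivative[OF blinfun.bounded_linear_left D2[OF that]] .
    have "((\<lambda>b. D1 ((x + t *\<^sub>R s) + b *\<^sub>R w) s + D1 ((x - t *\<^sub>R s) + b *\<^sub>R (- w)) (- s))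
        has_real_derivative \<phi>'' b t) (at b)"
      unfolding \<phi>''_def
      by (rule DERIV_add; rule DERIV_along_line[where g = "\<lambda>y. D1 y u" for u, OF D])
        (use inb[of t b] that in \<open>simp_all add: algebra_simps\<close>)
    then show ?thesis unfolding \<phi>'_def by (simp add: algebra_simps)
  qed
  \<comment> \<open>This form of the mean value theorem asks for differentiability only inside the
    interval; at \<open>t = 1\<close> continuity of \<open>f\<close> on \<open>X\<close>
    suffices.\<close>
  have "\<exists>l z. 0 < z \<and> z < 1 \<and> ((\<lambda>t. \<phi> 1 t - \<phi> 0 t) has_real_derivative l) (at z)
      \<and> (\<phi> 1 1 - \<phi> 0 1) - (\<phi> 1 0 - \<phi> 0 0) = (1 - 0) * l"
    using D\<phi>[of 0] D\<phi>[of 1]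
    by (intro MVT continuous_on_diff cont_\<phi>)
      (auto simp: real_differentiable_def intro: DERIV_diff)
  then obtain l a where a: "0 < a" "a < 1" "((\<lambda>t. \<phi> 1 t - \<phi> 0 t) has_real_derivative l) (at a)"
    and l: "(\<phi> 1 1 - \<phi> 0 1) - (\<phi> 1 0 - \<phi> 0 0) = l" by auto
  have "((\<lambda>t. \<phi> 1 t - \<phi> 0 t) has_real_derivative \<phi>' 1 a - \<phi>' 0 a) (at a)"
    using D\<phi>[of 0 a] D\<phi>[of 1 a] a by (intro DERIV_diff) auto
  then have l': "l = \<phi>' 1 a - \<phi>' 0 a" using a DERIV_unique by blast
  \<comment> \<open>As \<open>0 < a < 1\<close>, the whole segment in \<open>b\<close> stays in the
    open ball, so the derivative exists up to both ends.\<close>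
  obtain b where b: "0 < b" "b < 1" "\<phi>' 1 a - \<phi>' 0 a = \<phi>'' b a"
    using MVT2[of 0 1 "\<lambda>b. \<phi>' b a" "\<lambda>b. \<phi>'' b a"] D\<phi>' a by auto
  show thesis
  proof (rule that[OF a(1,2) b(1,2)])
    have "(f (x + (s + w)) - f (x + s) - f (x + w) + f x)
      + (f (x - (s + w)) - f (x - s) - f (x - w) + f x)
      = (\<phi> 1 1 - \<phi> 0 1) - (\<phi> 1 0 - \<phi> 0 0)"
      by (simp add: \<phi>_def algebra_simps)
    also have "\<dots> = \<phi>'' b a" using l l' b by simp
    also have "\<dots> = D2 (x + (a *\<^sub>R s + b *\<^sub>R w)) w s + D2 (x - (a *\<^sub>R s + b *\<^sub>R w)) w s"
      by (simp add: \<phi>''_def blinfun.minus_right blinfun.minus_left algebra_simps)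
    finally show "(f (x + (s + w)) - f (x + s) - f (x + w) + f x)
      + (f (x - (s + w)) - f (x - s) - f (x - w) + f x)
      = D2 (x + (a *\<^sub>R s + b *\<^sub>R w)) w s + D2 (x - (a *\<^sub>R s + b *\<^sub>R w)) w s" .
  qed
qed

text \<open>The two intermediate points are offset from \<open>x\<close> by opposite vectors, so the
  first-order terms of \<open>D2\<close> cancel and the Lipschitz bound on \<open>D3\<close>
  controls the rest to second order.\<close>

lemma centered_mixed_difference_le:
  fixes f :: "'a::real_normed_vector \<Rightarrow> real"
    and D3 :: "'a \<Rightarrow> 'a \<Rightarrow>\<^sub>L 'a \<Rightarrow>\<^sub>L 'a \<Rightarrow>\<^sub>L real"
  assumes D1: "\<And>y. y \<in> ball x r \<Longrightarrow> (f has_derivative blinfun_apply (D1 y)) (at y)"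
    and D2: "\<And>y. y \<in> ball x r \<Longrightarrow> (D1 has_derivative blinfun_apply (D2 y)) (at y)"
    and D3: "\<And>y. y \<in> ball x r \<Longrightarrow> (D2 has_derivative blinfun_apply (D3 y)) (at y)"
    and lip: "L-lipschitz_on (ball x r) D3"
    and cont: "continuous_on X f" and X: "ball x r \<subseteq> X"
    and mem: "x + (s + w) \<in> X" "x - (s + w) \<in> X"
    and le: "norm s + norm w \<le> r" and w: "w \<noteq> 0"
  shows "\<bar>(f (x + (s + w)) - f (x + s) - f (x + w) + f x)
      + (f (x - (s + w)) - f (x - s) - f (x - w) + f x) - 2 * D2 x w s\<bar>
    \<le> L * norm s * norm w * (norm s + norm w)\<^sup>2"
proof (cases "s = 0")
  \<comment> \<open>A column of \<open>S\<close> may vanish; then both sides are zero, whereas the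
    mean value lemma asks for a non-zero \<open>s\<close>.\<close>
  case True
  then show ?thesis by simp
next
  case False
  obtain a b where ab: "0 < a" "a < 1" "0 < b" "b < 1"
    and eq: "(f (x + (s + w)) - f (x + s) - f (x + w) + f x)
      + (f (x - (s + w)) - f (x - s) - f (x - w) + f x)
     = D2 (x + (a *\<^sub>R s + b *\<^sub>R w)) w s + D2 (x - (a *\<^sub>R s + b *\<^sub>R w)) w s"
    using mixed_difference_mvt[OF D1 D2 cont X mem le False w] by blast
  define p where "p = a *\<^sub>R s + b *\<^sub>R w"
  have L: "0 \<le> L" using lip by (rule lipschitz_on_nonneg)
  have "norm p \<le> a * norm s + b * norm w"
    using norm_triangle_ineq[of "a *\<^sub>R s" "b *\<^sub>R w"] ab by (simp add: p_def)
  also have "\<dots> < 1 * norm s + 1 * norm w"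
    using ab False w by (intro add_strict_mono mult_strict_right_mono) auto
  finally have p: "norm p < norm s + norm w" by simp
  have "\<bar>D2 (x + p) w s + D2 (x - p) w s - 2 * D2 x w s\<bar> \<le> (L * norm w * norm s) * (norm p)\<^sup>2"
  proof (rule abs_symmetric_second_difference_le[where r = r and q' = "\<lambda>y u. D3 y u w s"])
    show "((\<lambda>y. D2 y w s) has_derivative (\<lambda>u. D3 y u w s)) (at y)" if "y \<in> ball x r" for y
      using bounded_linear.has_derivative[OF blinfun.bounded_linear_left
          bounded_linear.has_derivative[OF blinfun.bounded_linear_left D3[OF that]]] .
    show "\<bar>D3 y u w s - D3 z u w s\<bar> \<le> L * norm w * norm s * norm (y - z) * norm u"
      if "y \<in> ball x r" "z \<in> ball x r" for y z u
    proof -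
      have "\<bar>D3 y u w s - D3 z u w s\<bar> = norm ((D3 y - D3 z) u w s)"
        by (simp add: blinfun.diff_left)
      also have "\<dots> \<le> norm (D3 y - D3 z) * norm u * norm w * norm s"
        by (meson norm_blinfun mult_right_mono norm_ge_zero order_trans)
      also have "\<dots> \<le> L * norm (y - z) * norm u * norm w * norm s"
        using lipschitz_onD[OF lip that] by (intro mult_right_mono) (auto simp: dist_norm)
      finally show ?thesis by (simp add: mult_ac)
    qed
  qed (use p le in simp)
  also have "\<dots> \<le> (L * norm w * norm s) * (norm s + norm w)\<^sup>2"
    using L p by (intro mult_left_mono power_mono) auto
  finally show ?thesis using eq by (simp add: p_def mult_ac)
qed


section \<open>Simplex Hessian with one column\<close>

lemma column_columnvector: "column i (columnvector w) = w"
  by (simp add: column_def columnvector_def)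

lemma column_uminus: "column i (- A) = - column i A"
  by (simp add: column_def vec_eq_iff)

lemma columnvector_uminus: "- columnvector w = columnvector (- w)" for w :: "real^'n"
  by (simp add: columnvector_def vec_eq_iff)

lemma transpose_uminus: "transpose (- A) = - transpose A" for A :: "real^'n^'m"
  by (simp add: transpose_def vec_eq_iff)

lemma simplex_gradient_columnvector:
  fixes w :: "real^'n"
  assumes "w \<noteq> 0"
  shows "simplex_gradient f x (columnvector w :: real^1^'n) = ((f (x + w) - f x) / (w \<bullet> w)) *\<^sub>R w"
  using assms
  by (simp add: simplex_gradient_def simplex_diff_def transpose_columnvector pinv_rowvector
      column_columnvector scaleR_matrix_vector_assoc[symmetric])
    (simp add: matrix_vector_mult_def columnvector_def vec_eq_iff)

text \<open>For \<open>w = h *\<^sub>R v\<close> one has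
  \<open>(w \<bullet> v) / (w \<bullet> w) = 1 / h\<close>, so pairing the one-direction gradients
  with \<open>v\<close> leaves plain difference quotients.\<close>

lemma simplex_hessian_columnvector_mult:
  fixes v :: "real^'n" and S :: "real^'m^'n"
  assumes "h \<noteq> 0" "v \<noteq> 0"
  shows "simplex_hessian f x S (columnvector (h *\<^sub>R v) :: real^1^'n) *v v = pinv (transpose S) *v
    (\<chi> j. (f (x + column j S + h *\<^sub>R v) - f (x + column j S) - f (x + h *\<^sub>R v) + f x) / h)"
proof -
  have "simplex_diff2 f x S (columnvector (h *\<^sub>R v) :: real^1^'n) *v v =
    (\<chi> j. (f (x + column j S + h *\<^sub>R v) - f (x + column j S) - f (x + h *\<^sub>R v) + f x) / h)"
    using assms
    by (simp add: simplex_diff2_def simplex_gradient_columnvector vec_eq_iff matrix_vector_mul_component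
        inner_diff_left)
      (simp add: field_simps)
  then show ?thesis
    by (simp add: simplex_hessian_def matrix_vector_mul_assoc[symmetric])
qed

text \<open>In the half built from \<open>- S\<close> and \<open>- T\<close> the pseudoinverse
  changes sign and the step is \<open>- h\<close>; the two signs cancel, so both halves add up under
  one \<open>pinv (transpose S)\<close>.\<close>

lemma centered_simplex_hessian_columnvector_mult:
  fixes v :: "real^'n" and S :: "real^'m^'n"
  assumes "h \<noteq> 0" "v \<noteq> 0" and w: "w = h *\<^sub>R v"
  shows "centered_simplex_hessian f x S (columnvector w :: real^1^'n) *v v = pinv (transpose S) *v
    (\<chi> j. ((f (x + (column j S + w)) - f (x + column j S) - f (x + w) + f x)
      + (f (x - (column j S + w)) - f (x - column j S) - f (x - w) + f x)) / (2 * h))"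
  (is "_ = _ *v ?d")
proof -
  let ?p = "\<chi> j. (f (x + column j S + w) - f (x + column j S) - f (x + w) + f x) / h"
  let ?m = "\<chi> j. (f (x - column j S - w) - f (x - column j S) - f (x - w) + f x) / (- h)"
  have p: "simplex_hessian f x S (columnvector w :: real^1^'n) *v v = pinv (transpose S) *v ?p"
    using simplex_hessian_columnvector_mult[OF assms(1,2), of f x S] by (simp add: w)
  have m: "simplex_hessian f x (- S) (- columnvector w :: real^1^'n) *v v = - pinv (transpose S) *v ?m"
    using simplex_hessian_columnvector_mult[of "- h" v f x "- S"] assms
    by (simp add: columnvector_uminus transpose_uminus pinv_uminus column_uminus)
  have "?d = (1 / 2) *\<^sub>R (?p - ?m)"
    using assms(1) by (simp add: vec_eq_iff field_simps)
  then show ?thesis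
    by (simp add: centered_simplex_hessian_def scaleR_matrix_vector_assoc[symmetric]
        matrix_vector_mult_add_rdistrib p m matrix_vector_mult_scaleR matrix_vector_mult_diff_distrib)
       (simp add: matrix_vector_mult_def vec_eq_iff sum_negf)
qed

text \<open>Links the coordinate \<open>hessian\<close> to the iterated derivative. The first
  argument of \<open>D2 x\<close> is the direction in which \<open>D1\<close> is differentiated, so
  the vector multiplied by the Hessian comes first.\<close>

lemma inner_hessian_mult:
  fixes f :: "real^'n \<Rightarrow> real"
  assumes U: "open U" "x \<in> U"
    and D1: "\<And>y. y \<in> U \<Longrightarrow> (f has_derivative blinfun_apply (D1 y)) (at y)"
    and D2: "(D1 has_derivative blinfun_apply (D2 x)) (at x)"
  shows "s \<bullet> (hessian f x *v w) = D2 x w s"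
proof -
  have "((\<lambda>y. \<chi> i. D1 y (axis i 1)) has_derivative (\<lambda>z. \<chi> i. D2 x z (axis i 1))) (at x)"
    by (rule iffD2[OF has_derivative_componentwise_within])
      (auto simp: Basis_vec_def inner_axis
        intro: bounded_linear.has_derivative[OF blinfun.bounded_linear_left D2])
  moreover have "(\<chi> i. D1 y (axis i 1)) = gradient f y" if "y \<in> U" for y
    using frechet_derivative_at[OF D1[OF that]] by (simp add: gradient_def)
  \<comment> \<open>The coordinate formula is known to equal \<open>gradient f\<close> only on
    \<open>U\<close>, whose openness transfers the derivative.\<close>
  ultimately have G: "(gradient f has_derivative (\<lambda>z. \<chi> i. D2 x z (axis i 1))) (at x)"
    using has_derivative_transform_within_open[OF _ U] by blast
  then have "hessian f x *v w = (\<chi> i. D2 x w (axis i 1))"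
    unfolding hessian_def frechet_derivative_at[OF G, symmetric]
    using has_derivative_linear[OF G] by (simp add: matrix_works)
  then have "s \<bullet> (hessian f x *v w) = (\<Sum>i\<in>UNIV. s $ i * D2 x w (axis i 1))"
    by (simp add: inner_vec_def)
  also have "\<dots> = D2 x w (\<Sum>i\<in>UNIV. s $ i *\<^sub>R axis i 1)"
    by (simp add: blinfun.sum_right blinfun.scaleR_right)
  also have "(\<Sum>i\<in>UNIV. s $ i *\<^sub>R axis i 1) = s"
    using basis_expansion[of s] by (simp add: scalar_mult_eq_scaleR)
  finally show ?thesis .
qed

section \<open>Error bound for the centered simplex Hessian\<close>

theorem theorem21:
  fixes f :: "real^'n \<Rightarrow> real" and D :: "(real^'n) set"
    and x0 v :: "real^'n" and S :: "real^'m^'n" and T :: "real^1^'n"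
    and h \<Delta> L \<Delta>T \<Delta>u \<Delta>l :: real
  assumes "x0 \<in> D" and "\<Delta> > 0"
    and "ball x0 \<Delta> \<subseteq> D" and "C4_on (ball x0 \<Delta>) f"
    and "differentiable3_on (cball x0 \<Delta> \<inter> D) f"
    and "L-lipschitz_on (cball x0 \<Delta> \<inter> D) (deriv3_on (cball x0 \<Delta> \<inter> D) f)"
    and "v \<noteq> 0" and "h \<noteq> 0" and "rank S \<noteq> 0"
    and "T = columnvector (h *\<^sub>R v)"
    and "centered_simplex_hessian_defined D x0 S T"
    and "\<Delta>T = norm (h *\<^sub>R v)"
    and "\<Delta>u = max (radius S) \<Delta>T" and "\<Delta>l = min (radius S) \<Delta>T"
    and "\<And>j. ball (x0 + column j S) \<Delta>T \<subseteq> ball x0 \<Delta>"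
  shows "norm (proj_vec S (centered_simplex_hessian f x0 S T *v v) - proj_vec S (hessian f x0 *v v))
           = norm (centered_simplex_hessian f x0 S T *v v - proj_vec S (hessian f x0 *v v)) \<and>
         norm (centered_simplex_hessian f x0 S T *v v - proj_vec S (hessian f x0 *v v))
           \<le> 2 * sqrt (real CARD('m)) * L * (\<Delta>u / \<Delta>l)
               * spectral_norm (pinv (transpose (normalized S))) * norm v * \<Delta>u\<^sup>2"
proof -
  define X where "X = cball x0 \<Delta> \<inter> D"
  define D1 where "D1 = deriv_on X f"
  define D2 where "D2 = deriv_on X D1"
  define D3 where "D3 = deriv_on X D2"
  define w where "w = h *\<^sub>R v"
  define p where "p = spectral_norm (pinv (transpose S))"
  note T = assms(10) and defd = assms(11) and ball_le = assms(15)
  have X: "ball x0 \<Delta> \<subseteq> X" using assms(3) by (auto simp: X_def)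
  \<comment> \<open>Points of the open ball are interior to \<open>X\<close>, so derivatives
    relative to \<open>X\<close> are ordinary ones there.\<close>
  have at: "y \<in> X" "at y within X = at y" if "y \<in> ball x0 \<Delta>" for y
    using that X at_within_interior[of y X] interior_maximal[OF X] by auto
  have diff: "f differentiable_on X" "D1 differentiable_on X" "D2 differentiable_on X"
    using assms(5) by (auto simp: differentiable3_on_def X_def D1_def D2_def)
  have der1: "(f has_derivative blinfun_apply (D1 y)) (at y)"
    and der2: "(D1 has_derivative blinfun_apply (D2 y)) (at y)"
    and der3: "(D2 has_derivative blinfun_apply (D3 y)) (at y)" if "y \<in> ball x0 \<Delta>" for y
    using deriv_on_works[OF diff(1) at(1)[OF that]] deriv_on_works[OF diff(2) at(1)[OF that]]
      deriv_on_works[OF diff(3) at(1)[OF that]] at(2)[OF that]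
    by (simp_all add: D1_def D2_def D3_def)
  have lip: "L-lipschitz_on (ball x0 \<Delta>) D3"
    using lipschitz_on_subset[OF assms(6)] X
    unfolding D3_def D2_def D1_def deriv3_on_def X_def by blast
  then have L: "0 \<le> L" by (rule lipschitz_on_nonneg)
  have w: "w \<noteq> 0" and \<Delta>T: "\<Delta>T = norm w" "0 < \<Delta>T"
    using assms(7,8,12) by (auto simp: w_def)
  have R: "0 < radius S" using radius_pos[OF assms(9)] .
  \<comment> \<open>At the end a factor \<open>1\<close> is enlarged to this ratio.\<close>
  have ratio: "1 \<le> \<Delta>u / \<Delta>l"
    using R \<Delta>T assms(13,14) by simp
  define E where "E j = (f (x0 + (column j S + w)) - f (x0 + column j S) - f (x0 + w) + f x0)
      + (f (x0 - (column j S + w)) - f (x0 - column j S) - f (x0 - w) + f x0)" for j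
  have E: "\<bar>E j - 2 * D2 x0 w (column j S)\<bar> \<le> 4 * L * radius S * \<Delta>T * \<Delta>u\<^sup>2" for j
  proof -
    let ?s = "column j S"
    \<comment> \<open>\<open>0 < \<Delta>T\<close> excludes an empty ball, so the inclusion bounds
      the sum of the norms; equality may put the corners on the sphere.\<close>
    have le: "norm ?s + norm w \<le> \<Delta>"
      using ball_le[of j] \<Delta>T by (simp add: ball_subset_ball_iff dist_norm)
    have "norm (?s + w) \<le> \<Delta>" using le norm_triangle_ineq[of ?s w] by linarith
    then have "x0 + (?s + w) \<in> cball x0 \<Delta>" "x0 - (?s + w) \<in> cball x0 \<Delta>"
      using norm_minus_cancel[of "?s + w"] by (simp_all add: dist_norm del: norm_minus_cancel)
    moreover have "x0 + (?s + w) \<in> D" "x0 - (?s + w) \<in> D"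
      using defd unfolding centered_simplex_hessian_defined_def T w_def[symmetric] column_columnvector
      by (auto simp: algebra_simps)
    ultimately have mem: "x0 + (?s + w) \<in> X" "x0 - (?s + w) \<in> X"
      by (simp_all add: X_def)
    have su: "norm ?s \<le> \<Delta>u" "norm w \<le> \<Delta>u"
      using norm_column_le_radius[of j S] assms(13) \<Delta>T by auto
    have "\<bar>E j - 2 * D2 x0 w ?s\<bar> \<le> L * norm ?s * norm w * (norm ?s + norm w)\<^sup>2"
      unfolding E_def
      using centered_mixed_difference_le[OF der1 der2 der3 lip _ X mem le w]
        differentiable_imp_continuous_on[OF diff(1)] by blast
    \<comment> \<open>The square contributes the factor 4. \<open>radius S\<close> and
      \<open>\<Delta>T\<close> stay separate: the first goes into the normalized pseudoinverse, the
      second becomes \<open>norm v\<close> on division by \<open>\<bar>h\<bar>\<close>.\<close>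
    also have "\<dots> \<le> L * radius S * \<Delta>T * (2 * \<Delta>u)\<^sup>2"
      using L R \<Delta>T su norm_column_le_radius[of j S]
      by (intro mult_mono power_mono) auto
    finally show ?thesis by (simp add: power_mult_distrib)
  qed
  define e where "e = (\<chi> j. (E j - 2 * D2 x0 w (column j S)) / (2 * h))"
  have c: "centered_simplex_hessian f x0 S T *v v = pinv (transpose S) *v (\<chi> j. E j / (2 * h))"
    using centered_simplex_hessian_columnvector_mult[OF assms(8,7) w_def, where f = f and x = x0 and S = S]
    by (simp only: T E_def w_def)
  have "transpose S *v (hessian f x0 *v v) = (\<chi> j. D2 x0 w (column j S) / h)"
  proof -
    have "(transpose S *v (hessian f x0 *v v)) $ j = D2 x0 w (column j S) / h" for j
    proof -
      have "(transpose S *v (hessian f x0 *v v)) $ j = column j S \<bullet> (hessian f x0 *v v)"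
        by (simp add: matrix_vector_mul_component transpose_def column_def)
      also have "\<dots> = D2 x0 v (column j S)"
        using assms(2)
        by (intro inner_hessian_mult[where U = "ball x0 \<Delta>" and ?D1.0 = D1]) (auto intro: der1 der2)
      also have "\<dots> = D2 x0 w (column j S) / h"
        using assms(8) by (simp add: w_def blinfun.scaleR_left blinfun.scaleR_right)
      finally show ?thesis .
    qed
    then show ?thesis by (simp add: vec_eq_iff)
  qed
  then have "centered_simplex_hessian f x0 S T *v v - proj_vec S (hessian f x0 *v v)
      = pinv (transpose S) *v ((\<chi> j. E j / (2 * h)) - (\<chi> j. D2 x0 w (column j S) / h))"
    by (simp add: c proj_vec_def matrix_vector_mul_assoc[symmetric] matrix_vector_mult_diff_distrib)
  also have "(\<chi> j. E j / (2 * h)) - (\<chi> j. D2 x0 w (column j S) / h) = e"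
    using assms(8) by (simp add: e_def vec_eq_iff field_simps)
  finally have d: "norm (centered_simplex_hessian f x0 S T *v v - proj_vec S (hessian f x0 *v v))
      = norm (pinv (transpose S) *v e)" by simp
  have "\<bar>e $ j\<bar> \<le> 2 * L * radius S * norm v * \<Delta>u\<^sup>2" for j
  proof -
    have "\<bar>e $ j\<bar> \<le> (4 * L * radius S * \<Delta>T * \<Delta>u\<^sup>2) / (2 * \<bar>h\<bar>)"
      using divide_right_mono[OF E[of j], of "2 * \<bar>h\<bar>"] by (simp add: e_def abs_mult)
    also have "\<dots> = 2 * L * radius S * norm v * \<Delta>u\<^sup>2"
      using assms(8) by (simp add: \<Delta>T w_def)
    finally show ?thesis .
  qed
  then have "norm e \<le> sqrt (real CARD('m)) * (2 * L * radius S * norm v * \<Delta>u\<^sup>2)"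
    by (rule norm_vec_le_sqrt_card)
  then have "p * norm e \<le> p * (sqrt (real CARD('m)) * (2 * L * radius S * norm v * \<Delta>u\<^sup>2))"
    by (intro mult_left_mono) (auto simp: p_def spectral_norm_nonneg)
  then have "norm (pinv (transpose S) *v e) \<le> p * (sqrt (real CARD('m)) * (2 * L * radius S * norm v * \<Delta>u\<^sup>2))"
    using norm_matrix_vector_le_spectral_norm[of "pinv (transpose S)" e]
    by (simp add: p_def)
  also have "\<dots> = 2 * sqrt (real CARD('m)) * L * 1
               * spectral_norm (pinv (transpose (normalized S))) * norm v * \<Delta>u\<^sup>2"
    using R by (simp add: spectral_norm_pinv_normalized p_def)
  also have "\<dots> \<le> 2 * sqrt (real CARD('m)) * L * (\<Delta>u / \<Delta>l)
               * spectral_norm (pinv (transpose (normalized S))) * norm v * \<Delta>u\<^sup>2"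
    using L ratio by (intro mult_right_mono mult_left_mono) (auto simp: spectral_norm_nonneg)
  finally have "norm (pinv (transpose S) *v e) \<le> \<dots>" .
  moreover have "proj_vec S (centered_simplex_hessian f x0 S T *v v) = centered_simplex_hessian f x0 S T *v v"
    by (simp add: c proj_vec_pinv)
  ultimately show ?thesis
    by (simp add: d)
qed

end
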